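(* Let $G=PSL_2(q)$, where $q\geq 4$ is a prime power, and let $p$ be an odd prime dividing $|G|$. If $q=2^{2n+1}\geq 8$ for some integer $n$ and $p=3$, then $w_p(G)=3$. Otherwise $w_p(G)=2$.
   Context: For a finite group $G$ and a prime $p$ dividing $|G|$, $I_p(G)$ denotes the set of elements of $G$ of order exactly $p$. The $p$-width $w_p(G)$ is the minimal $k\in\mathbb{N}$ such that every $g\in G$ can be written as a product of at most $k$ elements of $I_p(G)$. *)

theory Defs
  imports
    "HOL-Analysis.Analysis"
    "HOL-Algebra.Multiplicative_Group"
    "HOL-Number_Theory.Prime_Powers"
    "HOL-Library.Extended_Nat"
begin

definition SL2 :: "('a::field ^ 2 ^ 2) monoid" where
  "SL2 = \<lparr>carrier = {A. det A = 1}, mult = (**), one = mat 1\<rparr>"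

definition group_centre :: "('a, 'b) monoid_scheme \<Rightarrow> 'a set" where
  "group_centre G = {z \<in> carrier G. \<forall>g \<in> carrier G. z \<otimes>\<^bsub>G\<^esub> g = g \<otimes>\<^bsub>G\<^esub> z}"

(* The field is the type 'a; PSL_2(q) is the case CARD('a) = q.
   Its elements are the cosets of the centre in SL2. *)
definition PSL2 :: "('a::field ^ 2 ^ 2) set monoid" where
  "PSL2 = SL2 Mod group_centre SL2"

definition elements_of_order :: "nat \<Rightarrow> ('a, 'b) monoid_scheme \<Rightarrow> 'a set" where
  "elements_of_order p G = {x \<in> carrier G. group.ord G x = p}"

definition products_upto :: "('a, 'b) monoid_scheme \<Rightarrow> 'a set \<Rightarrow> nat \<Rightarrow> 'a set" where
  "products_upto G S k =
     {foldr (\<otimes>\<^bsub>G\<^esub>) xs \<one>\<^bsub>G\<^esub> | xs. set xs \<subseteq> S \<and> length xs \<le> k}"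

(* Valued in enat so that the width is \<infinity>, and not an unspecified number,
   when no such k exists. The infimum is a minimum whenever it is finite. *)
definition p_width :: "nat \<Rightarrow> ('a, 'b) monoid_scheme \<Rightarrow> enat" where
  "p_width p G = Inf {enat k | k. carrier G \<subseteq> products_upto G (elements_of_order p G) k}"

lemma group_SL2: "group (SL2 :: ('a::field ^ 2 ^ 2) monoid)"
proof (rule groupI)
  fix A :: "'a ^ 2 ^ 2" assume A: "A \<in> carrier SL2"
  define B :: "'a ^ 2 ^ 2" where
    "B = (\<chi> i j. if i = j then (if i = 1 then A $ 2 $ 2 else A $ 1 $ 1) else - A $ i $ j)"
  have d: "A $ 1 $ 1 * A $ 2 $ 2 - A $ 1 $ 2 * A $ 2 $ 1 = 1"
    using A by (simp add: SL2_def det_2)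
  have "det B = 1" using d by (simp add: B_def det_2 mult.commute)
  moreover have "B ** A = mat 1" using d
    by (auto simp: B_def vec_eq_iff matrix_matrix_mult_def mat_def sum_2 forall_2 algebra_simps)
  ultimately show "\<exists>B \<in> carrier SL2. B \<otimes>\<^bsub>SL2\<^esub> A = \<one>\<^bsub>SL2\<^esub>"
    by (auto simp: SL2_def)
qed (auto simp: SL2_def det_mul matrix_mul_assoc)

lemma (in group) group_centre_normal: "group_centre G \<lhd> G"
proof -
  have "subgroup (group_centre G) G"
  proof (rule subgroupI)
    fix a assume a: "a \<in> group_centre G"
    then have "a \<in> carrier G" by (simp add: group_centre_def)
    moreover have "inv a \<otimes> g = g \<otimes> inv a" if g: "g \<in> carrier G" for g
    proof -
      have "a \<otimes> inv g = inv g \<otimes> a" using a g by (simp add: group_centre_def)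
      then have "inv (a \<otimes> inv g) = inv (inv g \<otimes> a)" by simp
      then show ?thesis using \<open>a \<in> carrier G\<close> g by (simp add: inv_mult_group)
    qed
    ultimately show "inv a \<in> group_centre G" by (simp add: group_centre_def)
  next
    fix a b assume ab: "a \<in> group_centre G" "b \<in> group_centre G"
    have "a \<otimes> b \<otimes> g = g \<otimes> (a \<otimes> b)" if g: "g \<in> carrier G" for g
    proof -
      have c: "a \<in> carrier G" "b \<in> carrier G" "a \<otimes> g = g \<otimes> a" "b \<otimes> g = g \<otimes> b"
        using ab g by (simp_all add: group_centre_def)
      have "a \<otimes> b \<otimes> g = a \<otimes> (b \<otimes> g)" using c(1,2) g by (rule m_assoc)
      also have "\<dots> = a \<otimes> (g \<otimes> b)" by (simp only: c(4))
      also have "\<dots> = a \<otimes> g \<otimes> b" using c(1) g c(2) by (rule m_assoc [symmetric])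
      also have "\<dots> = g \<otimes> a \<otimes> b" by (simp only: c(3))
      also have "\<dots> = g \<otimes> (a \<otimes> b)" using g c(1,2) by (rule m_assoc)
      finally show ?thesis .
    qed
    moreover have "a \<otimes> b \<in> carrier G" using ab unfolding group_centre_def by blast
    ultimately show "a \<otimes> b \<in> group_centre G" unfolding group_centre_def by blast
  next
    show "group_centre G \<subseteq> carrier G" by (simp add: group_centre_def)
  next
    have "\<one> \<in> group_centre G" by (simp add: group_centre_def)
    then show "group_centre G \<noteq> {}" by blast
  qed
  moreover have "x \<otimes> h \<otimes> inv x = h" if x: "x \<in> carrier G" and h: "h \<in> group_centre G" for x h
  proof -
    have c: "h \<in> carrier G" "h \<otimes> x = x \<otimes> h" using x h by (simp_all add: group_centre_def)
    have "x \<otimes> h \<otimes> inv x = h \<otimes> x \<otimes> inv x" by (simp only: c(2))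
    then show ?thesis using x c(1) by (simp add: m_assoc)
  qed
  ultimately show ?thesis by (simp add: normal_inv_iff)
qed

lemma group_PSL2: "group (PSL2 :: ('a::field ^ 2 ^ 2) set monoid)"
  unfolding PSL2_def
  by (intro normal.factorgroup_is_group group.group_centre_normal group_SL2)

end

theory Submission
  imports Defs "HOL-Algebra.Sylow"
begin

text \<open>
  By Cayley--Hamilton, whether a non-scalar matrix in \<open>SL\<^sub>2\<close> has order \<open>p\<close> modulo the centre
  depends only on its trace, and by Cauchy's theorem some trace \<open>\<tau>\<close> is admissible. A
  non-scalar \<open>M\<close> of trace \<open>t\<close> is conjugate to its companion matrix \<open>C\<close>, and writing \<open>C = AB\<close>
  with \<open>tr A = \<tau>\<close>, \<open>tr B = \<sigma>\<close> amounts to finding a point on an affine conic whose quadratic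
  part has discriminant \<open>t\<^sup>2 - 4\<close>. For \<open>t\<^sup>2 \<noteq> 4\<close> a point always exists (pigeonhole for odd \<open>q\<close>,
  surjectivity of squaring for even \<open>q\<close>). If \<open>q\<close> is odd, the case \<open>t = 2\<close> reduces to \<open>t = -2\<close>
  by a sign change, where there is an explicit point; an admissible trace \<open>\<plusminus>2\<close> only
  needs explicit unipotent factors. If \<open>q\<close> is even and \<open>t = 0\<close>, there is an
  explicit point once two distinct admissible traces are available; these are \<open>\<tau>\<close> and \<open>\<tau>\<^sup>2\<close>
  unless \<open>p = 3\<close>. For \<open>p = 3\<close> the only trace is \<open>1\<close> and the equation becomes
  \<open>z\<^sup>2 + z + 1 = 0\<close> with \<open>z = c + d\<close>, which is solvable over the field exactly when \<open>q\<close> is a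
  power of \<open>4\<close>; otherwise involutions need a third factor.
\<close>

section \<open>Two-by-two matrices\<close>

lemma trace_2: "trace (A :: 'a::comm_ring_1^2^2) = A$1$1 + A$2$2"
  by (simp add: trace_def sum_2)

definition mat2 :: "'a \<Rightarrow> 'a \<Rightarrow> 'a \<Rightarrow> 'a \<Rightarrow> 'a::field^2^2" where
  "mat2 a b c d = vector [vector [a, b], vector [c, d]]"

lemma mat2_nth [simp]:
  "mat2 a b c d $ 1 $ 1 = a" "mat2 a b c d $ 1 $ 2 = b"
  "mat2 a b c d $ 2 $ 1 = c" "mat2 a b c d $ 2 $ 2 = d"
  by (simp_all add: mat2_def)

lemma mat2_eta: "(A :: 'a::field^2^2) = mat2 (A$1$1) (A$1$2) (A$2$1) (A$2$2)"
  by (simp add: vec_eq_iff forall_2)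

lemma mat2_cases:
  fixes A :: "'a::field^2^2"
  obtains a b c d where "A = mat2 a b c d"
  using mat2_eta by blast

lemma mat2_eq_iff [simp]:
  "mat2 a b c d = mat2 a' b' c' d' \<longleftrightarrow> a = a' \<and> b = b' \<and> c = c' \<and> d = d'"
  by (metis mat2_nth)

lemma mat2_mult [simp]:
  "mat2 a b c d ** mat2 a' b' c' d' =
     mat2 (a * a' + b * c') (a * b' + b * d') (c * a' + d * c') (c * b' + d * d')"
  by (simp add: vec_eq_iff forall_2 matrix_matrix_mult_def sum_2)

lemma mat2_uminus [simp]: "- mat2 a b c d = mat2 (- a) (- b) (- c) (- d)"
  by (simp add: vec_eq_iff forall_2)

lemma mat_eq_mat2: "mat k = mat2 k 0 0 k"
  by (simp add: vec_eq_iff forall_2 mat_def)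

lemma det_mat2 [simp]: "det (mat2 a b c d) = a * d - b * c"
  by (simp add: det_2)

lemma trace_mat2 [simp]: "trace (mat2 a b c d) = a + d"
  by (simp add: trace_2)

definition scalar :: "'a::field^2^2 \<Rightarrow> bool" where
  "scalar A \<longleftrightarrow> A$1$2 = 0 \<and> A$2$1 = 0 \<and> A$1$1 = A$2$2"

lemma scalar_mat2 [simp]: "scalar (mat2 a b c d) \<longleftrightarrow> b = 0 \<and> c = 0 \<and> a = d"
  by (simp add: scalar_def)

lemma scalar_iff_mat: "scalar A \<longleftrightarrow> (\<exists>k. A = mat k)"
  by (cases A rule: mat2_cases) (auto simp: mat_eq_mat2)

lemma SL2_simps [simp]:
  "A \<in> carrier SL2 \<longleftrightarrow> det A = 1" "A \<otimes>\<^bsub>SL2\<^esub> B = A ** B" "\<one>\<^bsub>SL2\<^esub> = mat 1"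
  by (simp_all add: SL2_def)

text \<open>Used contrapositively: a trace whose square is not 4 certifies that a matrix of
  determinant 1 is not scalar.\<close>

lemma trace_square_scalar:
  assumes "det A = 1" "scalar A"
  shows "(trace A)\<^sup>2 = (4::'a::field)"
  using assms by (cases A rule: mat2_cases) (auto simp: power2_eq_square algebra_simps)

lemma group_centre_SL2:
  "group_centre SL2 = {A :: 'a::field^2^2. det A = 1 \<and> scalar A}"
proof (rule Set.set_eqI)
  fix A :: "'a^2^2"
  obtain a b c d where A: "A = mat2 a b c d" by (rule mat2_cases)
  have "scalar A" if "\<forall>B. det B = 1 \<longrightarrow> A ** B = B ** A"
  proof -
    \<comment> \<open>Commuting with the two elementary transvections already forces a scalar
      matrix.\<close>
    have "A ** mat2 1 1 0 1 = mat2 1 1 0 1 ** A" "A ** mat2 1 0 1 1 = mat2 1 0 1 1 ** A"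
      using that by simp_all
    then have "c = 0" "a + b = b + d" "b = 0" unfolding A mat2_mult mat2_eq_iff by simp_all
    then show ?thesis by (simp add: A)
  qed
  moreover have "A ** B = B ** A" if "scalar A" for B
    using that A by (cases B rule: mat2_cases) (auto simp: mult.commute)
  ultimately show "A \<in> group_centre SL2 \<longleftrightarrow> A \<in> {A. det A = 1 \<and> scalar A}"
    unfolding group_centre_def mem_Collect_eq SL2_simps Ball_def by blast
qed

text \<open>The Lucas sequence with parameters \<open>t\<close> and 1, a rescaled Chebyshev
  polynomial of the second kind. If \<open>t\<close> = x + 1/x with x distinct from 1/x, its n-th
  term is (x^n - x^(-n)) / (x - 1/x).\<close>

fun lucas :: "'a::field \<Rightarrow> nat \<Rightarrow> 'a" where
  "lucas t 0 = 0"
| "lucas t (Suc 0) = 1"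
| "lucas t (Suc (Suc n)) = t * lucas t (Suc n) - lucas t n"

text \<open>Iterated Cayley--Hamilton.\<close>

lemma SL2_pow:
  fixes a b c d :: "'a::field"
  assumes "a * d - b * c = 1"
  defines "u \<equiv> lucas (a + d)"
  shows "mat2 a b c d [^]\<^bsub>SL2\<^esub> Suc n =
    mat2 (u (Suc n) * a - u n) (u (Suc n) * b) (u (Suc n) * c) (u (Suc n) * d - u n)"
proof (induction n)
  case 0
  then show ?case
    by (simp add: u_def mat_eq_mat2 nat_pow_def)
next
  case (Suc n)
  have "mat2 a b c d [^]\<^bsub>SL2\<^esub> Suc (Suc n) = mat2 a b c d [^]\<^bsub>SL2\<^esub> Suc n ** mat2 a b c d"
    by (simp add: nat_pow_def)
  also have "\<dots> = mat2 (u (Suc n) * a - u n) (u (Suc n) * b) (u (Suc n) * c) (u (Suc n) * d - u n)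
      ** mat2 a b c d"
    by (simp only: Suc)
  also have "\<dots> = mat2 (u (Suc (Suc n)) * a - u (Suc n)) (u (Suc (Suc n)) * b)
      (u (Suc (Suc n)) * c) (u (Suc (Suc n)) * d - u (Suc n))"
  proof -
    have bc: "x * b * c = x * a * d - x" for x
      using arg_cong[OF assms(1), of "(*) x"] by (simp add: algebra_simps)
    have "u (Suc (Suc n)) = (a + d) * u (Suc n) - u n" by (simp add: u_def)
    moreover have "(x * a - y) * a + x * b * c = ((a + d) * x - y) * a - x"
      "x * c * b + (x * d - y) * d = ((a + d) * x - y) * d - x"
      "(x * a - y) * b + x * b * d = ((a + d) * x - y) * b"
      "x * c * a + (x * d - y) * c = ((a + d) * x - y) * c" for x y
      using bc[of x] by (simp_all add: algebra_simps)
    ultimately show ?thesis by simp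
  qed
  finally show ?case .
qed

text \<open>By \<open>SL2_pow\<close> the n-th power is \<open>lucas (trace A) n\<close> times
  \<open>A\<close> plus a scalar matrix, and \<open>A\<close> is not scalar.\<close>

lemma scalar_SL2_pow:
  assumes "det A = 1" "\<not> scalar A" "n > 0"
  shows "scalar (A [^]\<^bsub>SL2\<^esub> n) \<longleftrightarrow> lucas (trace A) n = 0"
proof -
  obtain a b c d where A: "A = mat2 a b c d" by (rule mat2_cases)
  obtain m where n: "n = Suc m" using assms(3) not0_implies_Suc by blast
  have "mat2 a b c d [^]\<^bsub>SL2\<^esub> Suc m =
    mat2 (lucas (a + d) (Suc m) * a - lucas (a + d) m) (lucas (a + d) (Suc m) * b)
      (lucas (a + d) (Suc m) * c) (lucas (a + d) (Suc m) * d - lucas (a + d) m)"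
    by (rule SL2_pow) (use assms(1) A in simp)
  then show ?thesis using assms(2) unfolding A n by auto
qed

section \<open>Elements of prime order in the projective group\<close>

text \<open>Sylow's theorem is applied with exponent 1, where the cofactor \<open>m\<close> may
  still be divisible by \<open>p\<close>. Any nontrivial element of the resulting subgroup of order
  \<open>p\<close> will do.\<close>

lemma (in group) Cauchy:
  assumes "finite (carrier G)" "Factorial_Ring.prime p" "p dvd Coset.order G"
  obtains x where "x \<in> carrier G" "x \<noteq> \<one>" "x [^] p = \<one>"
proof -
  obtain m where "Coset.order G = p ^ 1 * m" using assms(3) by auto
  from sylow_thm[OF assms(2) group_axioms this assms(1)]
  obtain H where H: "subgroup H G" "card H = p" by auto
  have "card H > 1" using H(2) assms(2) prime_gt_1_nat by blast
  then obtain x where x: "x \<in> H" "x \<noteq> \<one>"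
    by (metis is_singletonI' is_singleton_altdef less_irrefl subgroup.one_closed H(1) all_not_in_conv)
  interpret HG: group "G\<lparr>carrier := H\<rparr>" using H(1) by (rule subgroup.subgroup_is_group) (rule group_axioms)
  have "x [^]\<^bsub>G\<lparr>carrier := H\<rparr>\<^esub> Coset.order (G\<lparr>carrier := H\<rparr>) = \<one>\<^bsub>G\<lparr>carrier := H\<rparr>\<^esub>"
    using x by (intro HG.pow_order_eq_1) auto
  then have "x [^] p = \<one>" using H(2) by (simp add: Coset.order_def nat_pow_def)
  then show thesis using that x subgroup.mem_carrier[OF H(1)] by blast
qed

lemma (in group) ord_eq_prime_iff:
  assumes "x \<in> carrier G" "Factorial_Ring.prime p"
  shows "ord x = p \<longleftrightarrow> x \<noteq> \<one> \<and> x [^] p = \<one>"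
proof -
  have "ord x = 1 \<longleftrightarrow> x = \<one>" using pow_eq_id[of x 1] assms(1) by simp
  then show ?thesis
    using pow_eq_id[OF assms(1), of p] assms(2) by (auto simp: prime_nat_iff)
qed

definition proj :: "'a::field^2^2 \<Rightarrow> ('a^2^2) set" where
  "proj A = group_centre SL2 #>\<^bsub>SL2\<^esub> A"

lemma normal_centre_SL2: "group_centre SL2 \<lhd> (SL2 :: ('a::field^2^2) monoid)"
  by (rule group.group_centre_normal[OF group_SL2])

lemma carrier_PSL2: "carrier PSL2 = proj ` {A. det A = 1}"
  by (auto simp: PSL2_def FactGroup_def RCOSETS_def proj_def)

lemma proj_mult:
  assumes "det A = 1" "det B = 1"
  shows "proj A \<otimes>\<^bsub>PSL2\<^esub> proj B = proj (A ** B)"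
  using normal.rcos_sum[OF normal_centre_SL2, of A B] assms
  by (simp add: PSL2_def FactGroup_def proj_def)

lemma proj_eqD:
  fixes A B :: "'a::field^2^2"
  assumes "det A = 1" "proj A = proj B"
  obtains c where "c * c = 1" "A = mat c ** B"
proof -
  have "A \<in> proj A" unfolding proj_def
    using group.rcos_self[OF group_SL2 _ normal_imp_subgroup[OF normal_centre_SL2]] assms(1) by simp
  then obtain z where z: "det z = 1" "scalar z" "A = z ** B"
    using assms(2) by (auto simp: proj_def r_coset_def group_centre_SL2)
  obtain k where k: "z = mat k" using z(2) scalar_iff_mat by blast
  have "k * k = 1" using z(1) k by (simp add: mat_eq_mat2)
  then show thesis using that z k by blast
qed

lemma proj_eq_one_iff:
  assumes "det A = 1"
  shows "proj A = \<one>\<^bsub>PSL2\<^esub> \<longleftrightarrow> scalar A"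
proof -
  note sub = normal_imp_subgroup[OF normal_centre_SL2]
  have "proj A = \<one>\<^bsub>PSL2\<^esub> \<longleftrightarrow> A \<in> group_centre SL2"
    using group.coset_join1[OF group_SL2 _ _ sub, of A] group.coset_join2[OF group_SL2 _ sub, of A] assms
    by (auto simp: PSL2_def FactGroup_def proj_def)
  then show ?thesis using assms by (simp add: group_centre_SL2)
qed

text \<open>The lifts \<open>A\<close> and \<open>- A\<close> have opposite traces. Hence the
  admissible traces are closed under negation, and a target of trace 2 may be exchanged for one of
  trace -2.\<close>

lemma proj_uminus:
  fixes A :: "'a::field^2^2"
  assumes "det A = 1"
  shows "proj (- A) = proj A"
proof -
  interpret group "PSL2 :: ('a^2^2) set monoid" by (rule group_PSL2)
  have "proj (- A) = proj (mat (-1)) \<otimes>\<^bsub>PSL2\<^esub> proj A"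
    using assms by (cases A rule: mat2_cases) (simp add: proj_mult mat_eq_mat2)
  also have "proj (mat (-1)) = (\<one>\<^bsub>PSL2\<^esub> :: ('a^2^2) set)"
    by (simp add: proj_eq_one_iff mat_eq_mat2)
  finally show ?thesis using assms by (simp add: carrier_PSL2)
qed

lemma det_SL2_pow: "det A = 1 \<Longrightarrow> det (A [^]\<^bsub>SL2\<^esub> (n::nat)) = 1"
  using monoid.nat_pow_closed[OF group.is_monoid[OF group_SL2], of A n] by simp

lemma proj_pow:
  fixes A :: "'a::field^2^2"
  assumes "det A = 1"
  shows "proj A [^]\<^bsub>PSL2\<^esub> (n::nat) = proj (A [^]\<^bsub>SL2\<^esub> n)"
proof (induction n)
  case 0
  then show ?case using proj_eq_one_iff[of "mat 1 :: 'a^2^2"] by (simp add: nat_pow_def mat_eq_mat2)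
next
  case (Suc n)
  then show ?case
    using assms proj_mult[OF det_SL2_pow[OF assms, of n] assms] by (simp add: nat_pow_def)
qed

lemma proj_in_elements_of_order:
  fixes A :: "'a::field^2^2"
  assumes "det A = 1" "Factorial_Ring.prime p"
  shows "proj A \<in> elements_of_order p PSL2 \<longleftrightarrow> \<not> scalar A \<and> lucas (trace A) p = 0"
proof -
  have "proj A \<in> carrier PSL2" using assms by (simp add: carrier_PSL2)
  moreover have "p > 0" using assms(2) by (simp add: prime_gt_0_nat)
  ultimately show ?thesis
    using group.ord_eq_prime_iff[OF group_PSL2 _ assms(2), of "proj A"] assms(1)
    by (auto simp: elements_of_order_def proj_pow proj_eq_one_iff det_SL2_pow scalar_SL2_pow)
qed

section \<open>Bounding the width by product sets\<close>

lemma products_upto_mono: "j \<le> k \<Longrightarrow> products_upto G S j \<subseteq> products_upto G S k"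
  unfolding products_upto_def using order_trans by blast

lemma p_width_eqI:
  assumes "carrier G \<subseteq> products_upto G (elements_of_order p G) (Suc k)"
    and "\<not> carrier G \<subseteq> products_upto G (elements_of_order p G) k"
  shows "p_width p G = enat (Suc k)"
  unfolding p_width_def
proof (rule antisym)
  show "Inf {enat k |k. carrier G \<subseteq> products_upto G (elements_of_order p G) k} \<le> enat (Suc k)"
    using assms(1) by (intro Inf_lower) auto
  show "enat (Suc k) \<le> Inf {enat k |k. carrier G \<subseteq> products_upto G (elements_of_order p G) k}"
  proof (rule Inf_greatest)
    fix x assume "x \<in> {enat k |k. carrier G \<subseteq> products_upto G (elements_of_order p G) k}"
    then obtain j where j: "x = enat j" "carrier G \<subseteq> products_upto G (elements_of_order p G) j"
      by auto
    have "\<not> j \<le> k" using products_upto_mono j(2) assms(2) by (metis subset_trans)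
    then show "enat (Suc k) \<le> x" using j(1) by simp
  qed
qed

lemma products_uptoI:
  "set xs \<subseteq> S \<Longrightarrow> length xs \<le> k \<Longrightarrow> foldr (\<otimes>\<^bsub>G\<^esub>) xs \<one>\<^bsub>G\<^esub> \<in> products_upto G S k"
  unfolding products_upto_def by blast

section \<open>Factorisations with prescribed traces\<close>

text \<open>A non-scalar matrix has a cyclic vector, so it is conjugate to its companion matrix.\<close>

lemma companion:
  fixes M :: "'a::field^2^2"
  assumes "det M = 1" "\<not> scalar M"
  obtains P Q where "P ** Q = mat 1" "Q ** P = mat 1" "M = P ** mat2 0 (-1) 1 (trace M) ** Q"
proof -
  obtain a b c d where M: "M = mat2 a b c d" by (rule mat2_cases)
  have bc: "a * d - b * c = 1" using assms M by simp
  \<comment> \<open>This is the determinant with columns v and \<open>M\<close> v for v = (x, y): a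
    quadratic form with coefficients c, d - a, -b. It vanishes identically only if \<open>M\<close>
    is scalar, and three values suffice to see this.\<close>
  have "\<exists>x y. x * (c * x + d * y) - (a * x + b * y) * y \<noteq> 0"
  proof (rule ccontr)
    assume "\<not> ?thesis"
    then have h: "x * (c * x + d * y) - (a * x + b * y) * y = 0" for x y by blast
    show False using h[of 1 0] h[of 0 1] h[of 1 1] assms(2) M by simp
  qed
  then obtain x y where e: "x * (c * x + d * y) - (a * x + b * y) * y \<noteq> 0" (is "?e \<noteq> 0") by blast
  define P where "P = mat2 x (a * x + b * y) y (c * x + d * y)"
  have "det P \<noteq> 0" using e by (simp add: P_def)
  then obtain Q where Q: "P ** Q = mat 1" "Q ** P = mat 1"
    using invertible_det_nz[of P] by (auto simp: invertible_def)
  have "M ** P = P ** mat2 0 (-1) 1 (trace M)"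
  proof -
    have "a * (a * x + b * y) + b * (c * x + d * y) = (a * x + b * y) * (a + d) - x * (a * d - b * c)"
      "c * (a * x + b * y) + d * (c * x + d * y) = (c * x + d * y) * (a + d) - y * (a * d - b * c)"
      by (simp_all add: algebra_simps)
    then show ?thesis unfolding bc M P_def by simp
  qed
  then have "M ** (P ** Q) = P ** mat2 0 (-1) 1 (trace M) ** Q" by (simp add: matrix_mul_assoc)
  then show thesis using that Q by simp
qed

text \<open>For the companion matrix C take \<open>A\<close> of trace \<open>\<tau>\<close> and let
  \<open>B\<close> be the inverse of \<open>A\<close> times C. The entry \<open>b\<close> is chosen
  so that \<open>B\<close> has trace \<open>\<sigma>\<close>; the conic is then exactly the
  remaining condition that \<open>A\<close> has determinant 1. Conjugation carries this over to
  \<open>M\<close>.\<close>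

lemma factor_with_traces:
  fixes M :: "'a::field^2^2"
  assumes "det M = 1" "\<not> scalar M"
    and "d\<^sup>2 + c\<^sup>2 - trace M * c * d - \<tau> * d + \<sigma> * c + 1 = 0"
  obtains A B where "M = A ** B" "det A = 1" "det B = 1" "trace A = \<tau>" "trace B = \<sigma>"
proof -
  define t where "t = trace M"
  define b where "b = \<sigma> + c - t * d"
  obtain P Q where PQ: "P ** Q = mat 1" "Q ** P = mat 1" and M: "M = P ** mat2 0 (-1) 1 t ** Q"
    using companion[OF assms(1,2)] unfolding t_def by blast
  define A where "A = mat2 d (-b) (-c) (\<tau> - d)"
  define B where "B = mat2 b (t * b - (\<tau> - d)) d (t * d - c)"
  have det: "(\<tau> - d) * d - b * c = 1"
  proof -
    have "(\<tau> - d) * d - b * c = 1 - (d\<^sup>2 + c\<^sup>2 - t * c * d - \<tau> * d + \<sigma> * c + 1)"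
      by (simp add: b_def algebra_simps power2_eq_square)
    then show ?thesis using assms(3) by (simp add: t_def)
  qed
  have AB: "A ** B = mat2 0 (-1) 1 t" unfolding A_def B_def
  proof -
    have "d * (t * b - (\<tau> - d)) - b * (t * d - c) = - ((\<tau> - d) * d - b * c)"
      "(\<tau> - d) * (t * d - c) - c * (t * b - (\<tau> - d)) = t * ((\<tau> - d) * d - b * c)"
      by (simp_all add: algebra_simps)
    then show "mat2 d (- b) (- c) (\<tau> - d) ** mat2 b (t * b - (\<tau> - d)) d (t * d - c) = mat2 0 (-1) 1 t"
      unfolding det mat2_mult mat2_eq_iff using det by (simp add: mult.commute)
  qed
  have dPQ: "det P * det Q = 1" using PQ(1) by (metis det_I det_mul)
  have detA: "det A = 1" using det by (simp add: A_def algebra_simps)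
  have "det A * det B = 1" using AB by (simp flip: det_mul)
  then have detB: "det B = 1" using detA by simp
  have conj: "det (P ** X ** Q) = det X" "trace (P ** X ** Q) = trace X" for X
  proof -
    show "det (P ** X ** Q) = det X" using dPQ by (simp add: det_mul algebra_simps)
    have "trace (P ** X ** Q) = trace (Q ** (P ** X))" by (rule trace_mul_sym)
    then show "trace (P ** X ** Q) = trace X" using PQ(2) by (simp add: matrix_mul_assoc)
  qed
  have "(P ** A ** Q) ** (P ** B ** Q) = P ** A ** (Q ** P) ** B ** Q" by (simp add: matrix_mul_assoc)
  also have "\<dots> = P ** (A ** B) ** Q" by (simp add: PQ(2) matrix_mul_assoc)
  finally have "M = (P ** A ** Q) ** (P ** B ** Q)" using AB M by simp
  then show thesis by (rule that) (simp_all add: conj detA detB, simp_all add: A_def B_def b_def)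
qed


lemma mult_in_products_upto:
  assumes "x \<in> S" "y \<in> products_upto G S k"
  shows "x \<otimes>\<^bsub>G\<^esub> y \<in> products_upto G S (Suc k)"
proof -
  obtain xs where xs: "set xs \<subseteq> S" "length xs \<le> k" "y = foldr (\<otimes>\<^bsub>G\<^esub>) xs \<one>\<^bsub>G\<^esub>"
    using assms(2) unfolding products_upto_def by blast
  then show ?thesis using assms(1) products_uptoI[of "x # xs" S "Suc k" G] by simp
qed

lemma one_in_products_upto: "\<one>\<^bsub>G\<^esub> \<in> products_upto G S k"
  using products_uptoI[of "[]"] by simp

lemma products_upto_0: "products_upto G S 0 = {\<one>\<^bsub>G\<^esub>}"
  by (auto simp: products_upto_def)

lemma products_upto_Suc:
  "products_upto G S (Suc k) =
    insert \<one>\<^bsub>G\<^esub> {x \<otimes>\<^bsub>G\<^esub> y | x y. x \<in> S \<and> y \<in> products_upto G S k}" (is "?L = ?R")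
proof
  show "?R \<subseteq> ?L" by (auto intro: mult_in_products_upto one_in_products_upto)
  show "?L \<subseteq> ?R"
  proof
    fix z assume "z \<in> ?L"
    then obtain xs where xs: "set xs \<subseteq> S" "length xs \<le> Suc k" "z = foldr (\<otimes>\<^bsub>G\<^esub>) xs \<one>\<^bsub>G\<^esub>"
      unfolding products_upto_def by blast
    show "z \<in> ?R"
    proof (cases xs)
      case (Cons x ys)
      then show ?thesis using xs products_uptoI[of ys S k G] by auto
    qed (use xs in simp)
  qed
qed

section \<open>Points on the conic\<close>

text \<open>Every fibre has at most two points, since two distinct points \<open>x\<close>,
  \<open>u\<close> of one fibre satisfy x + u = -b/a.\<close>

lemma card_quadratic_image:
  fixes a b c :: "'a::{field,finite}"
  assumes "a \<noteq> 0"
  shows "CARD('a) \<le> 2 * card (range (\<lambda>x. a * x\<^sup>2 + b * x + c))"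
proof -
  define f where "f = (\<lambda>x. a * x\<^sup>2 + b * x + c)"
  have fib: "card (f -` {y}) \<le> 2" for y
  proof (cases "f -` {y} = {}")
    case False
    then obtain u where u: "f u = y" by auto
    have "f -` {y} \<subseteq> {u, - b / a - u}"
    proof
      fix x assume "x \<in> f -` {y}"
      moreover have "(x - u) * (a * (x + u) + b) = f x - f u"
        by (simp add: f_def algebra_simps power2_eq_square)
      ultimately have "(x - u) * (a * (x + u) + b) = 0" using u by (simp only: vimage_singleton_eq diff_self)
      then consider "x = u" | "(x + u) * a = - b"
        by (auto simp only: mult_eq_0_iff right_minus_eq eq_neg_iff_add_eq_0 mult.commute)
      then show "x \<in> {u, - b / a - u}"
      proof cases
        case 2
        then have "x + u = - b / a" using assms by (metis nonzero_mult_div_cancel_right)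
        then show ?thesis by (simp add: eq_diff_eq)
      qed simp
    qed
    then have "card (f -` {y}) \<le> card {u, - b / a - u}" by (intro card_mono) auto
    also have "\<dots> \<le> 2" by (simp add: card_insert_if)
    finally show ?thesis .
  qed simp
  have "(\<Union>y\<in>range f. f -` {y}) = UNIV" by blast
  then have "CARD('a) = card (\<Union>y\<in>range f. f -` {y})" by simp
  also have "\<dots> \<le> (\<Sum>y\<in>range f. card (f -` {y}))" by (rule card_UN_le) simp
  also have "\<dots> \<le> card (range f) * 2"
    using sum_bounded_above[of "range f", OF fib] by simp
  finally show ?thesis unfolding f_def by simp
qed

text \<open>Translation by 1 permutes the field, so summing x + 1 and summing x over all x give the
  same result.\<close>

lemma of_nat_CARD: "of_nat CARD('a) = (0::'a::{field,finite})"
proof -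
  have "(\<Sum>x\<in>UNIV. x + 1) = (\<Sum>x\<in>UNIV. x::'a)"
    by (rule sum.reindex_bij_witness[of _ "\<lambda>x. x - 1" "\<lambda>x. x + 1"]) auto
  then show ?thesis by (simp add: sum.distrib)
qed

lemma two_neq_0_if_odd_CARD:
  assumes "odd CARD('a::{field,finite})"
  shows "(2::'a) \<noteq> 0"
proof
  assume 2: "(2::'a) = 0"
  obtain m where "CARD('a) = 2 * m + 1" using assms oddE by blast
  then have "of_nat CARD('a) = (2::'a) * of_nat m + 1" by simp
  then show False using 2 of_nat_CARD[where 'a = 'a] by simp
qed

lemma two_eq_0_if_CARD_power_2:
  assumes "CARD('a::{field,finite}) = 2 ^ k"
  shows "(2::'a) = 0"
  using of_nat_CARD[where 'a = 'a] assms by simp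

lemma primepow_evenE:
  assumes "primepow (q::nat)" "even q"
  obtains k where "q = 2 ^ k"
proof -
  obtain p k where pk: "Factorial_Ring.prime p" "q = p ^ k" using assms(1) unfolding primepow_def by blast
  then have "p = 2" using assms(2) prime_dvd_power primes_dvd_imp_eq two_is_prime_nat by metis
  then show thesis using that pk by simp
qed

text \<open>Squaring is additive in characteristic 2, hence injective, hence surjective on a finite
  field.\<close>

lemma char_2_square_surj:
  assumes "(2::'a::{field,finite}) = 0"
  obtains x where "x\<^sup>2 = (y::'a)"
proof -
  have "inj (\<lambda>x::'a. x\<^sup>2)"
  proof (rule injI)
    fix u v :: 'a assume "u\<^sup>2 = v\<^sup>2"
    moreover have "(u - v)\<^sup>2 = u\<^sup>2 - v\<^sup>2 - 2 * v * (u - v)"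
      by (simp add: algebra_simps power2_eq_square)
    ultimately have "(u - v)\<^sup>2 = 0" using assms by simp
    then show "u = v" by simp
  qed
  then have "surj (\<lambda>x::'a. x\<^sup>2)" by (simp add: finite_UNIV_inj_surj)
  then show thesis using that by (metis surjD)
qed

lemma four_eq_2_mult_2: "(4::'a::field) = 2 * 2"
  by simp

lemma conic_point:
  fixes t \<tau> \<sigma> :: "'a::{field,finite}"
  assumes t: "t\<^sup>2 \<noteq> 4" and q: "primepow CARD('a)"
  obtains c d where "d\<^sup>2 + c\<^sup>2 - t * c * d - \<tau> * d + \<sigma> * c + 1 = 0"
proof (cases "(2::'a) = 0")
  case True
  then have "t \<noteq> 0" using t four_eq_2_mult_2[where 'a = 'a] by auto
  \<comment> \<open>This \<open>c\<close> cancels the terms linear in d, leaving an equation for the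
    square of d alone.\<close>
  define c where "c = \<tau> / t"
  have c: "t * c = \<tau>" using \<open>t \<noteq> 0\<close> by (simp add: c_def)
  obtain d where "d\<^sup>2 = c\<^sup>2 + \<sigma> * c + 1" using char_2_square_surj[OF True] by blast
  moreover have "d\<^sup>2 + c\<^sup>2 - t * c * d - \<tau> * d + \<sigma> * c + 1 =
      (d\<^sup>2 - (c\<^sup>2 + \<sigma> * c + 1)) - (t * c - \<tau>) * d + 2 * (c\<^sup>2 + \<sigma> * c + 1 - \<tau> * d)"
    by (simp add: algebra_simps)
  ultimately have "d\<^sup>2 + c\<^sup>2 - t * c * d - \<tau> * d + \<sigma> * c + 1 = 0" using True c by simp
  then show thesis by (rule that)
next
  case False
  have "odd CARD('a)"
  proof (rule ccontr)
    assume "\<not> odd CARD('a)"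
    then obtain k where "CARD('a) = 2 ^ k" using primepow_evenE[OF q] by blast
    then show False using two_eq_0_if_CARD_power_2 False by blast
  qed
  \<comment> \<open>Completing the square in d turns four times the equation into (2d - tc -
    \<open>\<tau>\<close>)^2 = \<open>f\<close> c. As t^2 differs from 4, \<open>f\<close> is a
    genuine quadratic in c.\<close>
  define e where "e = (t\<^sup>2 - 4)"
  define f where "f = (\<lambda>c. e * c\<^sup>2 + (2 * t * \<tau> - 4 * \<sigma>) * c + (\<tau>\<^sup>2 - 4))"
  define g where "g = (\<lambda>x::'a. 1 * x\<^sup>2 + 0 * x + 0)"
  have "CARD('a) \<le> 2 * card (range f)" "CARD('a) \<le> 2 * card (range g)"
    unfolding f_def g_def using t by (intro card_quadratic_image; simp add: e_def)+
  \<comment> \<open>For odd q both images have at least (q + 1)/2 elements, so they meet.\<close>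
  then have "card (range f) + card (range g) > CARD('a)"
    using \<open>odd CARD('a)\<close> by presburger
  moreover have "card (range f \<union> range g) \<le> CARD('a)" by (intro card_mono) auto
  ultimately have "range f \<inter> range g \<noteq> {}"
    using card_Un_disjoint[of "range f" "range g"] finite[of "range f"] finite[of "range g"] by linarith
  then obtain c x where "f c = g x" by blast
  then have x: "x\<^sup>2 = e * c\<^sup>2 + (2 * t * \<tau> - 4 * \<sigma>) * c + (\<tau>\<^sup>2 - 4)" by (simp add: f_def g_def)
  define d where "d = (x + t * c + \<tau>) / 2"
  have "2 * d = x + t * c + \<tau>" using False by (simp add: d_def)
  then have xd: "x = 2 * d - t * c - \<tau>" by simp
  have "4 * (d\<^sup>2 + c\<^sup>2 - t * c * d - \<tau> * d + \<sigma> * c + 1) =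
      x\<^sup>2 - (e * c\<^sup>2 + (2 * t * \<tau> - 4 * \<sigma>) * c + (\<tau>\<^sup>2 - 4))"
    unfolding xd by (simp add: e_def algebra_simps power2_eq_square)
  then have "4 * (d\<^sup>2 + c\<^sup>2 - t * c * d - \<tau> * d + \<sigma> * c + 1) = 0"
    using x by simp
  moreover have "(4::'a) \<noteq> 0" using False by (simp only: four_eq_2_mult_2 mult_eq_0_iff simp_thms)
  ultimately have "d\<^sup>2 + c\<^sup>2 - t * c * d - \<tau> * d + \<sigma> * c + 1 = 0"
    by (simp only: mult_eq_0_iff simp_thms)
  then show thesis by (rule that)
qed


section \<open>Products of two and three elements\<close>

lemma det_uminus_2 [simp]: "det (- A) = det (A :: 'a::field^2^2)"
  by (cases A rule: mat2_cases) simp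

lemma trace_uminus_2 [simp]: "trace (- A) = - trace (A :: 'a::field^2^2)"
  by (cases A rule: mat2_cases) simp

lemma scalar_uminus [simp]: "scalar (- A) \<longleftrightarrow> scalar A"
  by (cases A rule: mat2_cases) simp

lemma trace_mult_self:
  fixes A :: "'a::field^2^2"
  assumes "det A = 1"
  shows "trace (A ** A) = (trace A)\<^sup>2 - 2"
  using assms
  by (cases A rule: mat2_cases) (auto simp: algebra_simps power2_eq_square)

lemma square_eq_4_iff: "(x::'a::field)\<^sup>2 = 4 \<longleftrightarrow> x = 2 \<or> x = - 2"
proof -
  have "x\<^sup>2 - 4 = (x - 2) * (x + 2)" by (simp add: algebra_simps power2_eq_square)
  then have "x\<^sup>2 = 4 \<longleftrightarrow> (x - 2) * (x + 2) = 0" by (metis right_minus_eq)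
  then show ?thesis by (simp only: mult_eq_0_iff right_minus_eq eq_neg_iff_add_eq_0)
qed

text \<open>At t = 0 the recursion just negates the term two places back. For odd primes this
  excludes trace 0 from the admissible traces.\<close>

lemma lucas_zero_odd: "odd n \<Longrightarrow> lucas (0::'a::field) n \<noteq> 0"
  by (induction n rule: induct_nat_012) auto

lemma proj_in_carrier: "det A = 1 \<Longrightarrow> proj A \<in> carrier PSL2"
  by (simp add: carrier_PSL2)

lemma proj_mult_in_products_upto:
  assumes "det A = 1" "det B = 1" "proj A \<in> S" "proj B \<in> products_upto PSL2 S k"
  shows "proj (A ** B) \<in> products_upto PSL2 S (Suc k)"
  using mult_in_products_upto[OF assms(3,4)] assms(1,2) by (simp add: proj_mult)

lemma proj_in_products_upto_1:
  fixes A :: "'a::field^2^2"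
  assumes "det A = 1" "proj A \<in> S"
  shows "proj A \<in> products_upto PSL2 S (Suc 0)"
proof -
  interpret group "PSL2 :: ('a^2^2) set monoid" by (rule group_PSL2)
  show ?thesis
    using mult_in_products_upto[OF assms(2) one_in_products_upto[of PSL2 S 0]] assms(1)
    by (simp add: proj_in_carrier)
qed

lemma proj_mult_in_products_upto_2:
  assumes "det A = 1" "det B = 1" "proj A \<in> S" "proj B \<in> S"
  shows "proj (A ** B) \<in> products_upto PSL2 S 2"
  using proj_mult_in_products_upto[OF assms(1-3) proj_in_products_upto_1[OF assms(2,4)]]
  by (simp add: numeral_2_eq_2)

lemma proj_scalar_in_products_upto:
  "det M = 1 \<Longrightarrow> scalar M \<Longrightarrow> proj M \<in> products_upto PSL2 S k"
  using one_in_products_upto[of PSL2 S k] proj_eq_one_iff[of M] by simp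

text \<open>The conditions on the squares of \<open>\<tau>\<close> and \<open>\<sigma>\<close> keep
  the factors from being scalar.\<close>

lemma proj_in_products_upto_2:
  fixes M :: "'a::field^2^2"
  assumes "Factorial_Ring.prime p" "det M = 1" "\<not> scalar M"
    and "lucas \<tau> p = 0" "\<tau>\<^sup>2 \<noteq> 4" "lucas \<sigma> p = 0" "\<sigma>\<^sup>2 \<noteq> 4"
    and "d\<^sup>2 + c\<^sup>2 - trace M * c * d - \<tau> * d + \<sigma> * c + 1 = 0"
  shows "proj M \<in> products_upto PSL2 (elements_of_order p PSL2) 2"
proof -
  obtain A B where AB: "M = A ** B" "det A = 1" "det B = 1" "trace A = \<tau>" "trace B = \<sigma>"
    using factor_with_traces[OF assms(2,3,8)] by blast
  have "\<not> scalar A" "\<not> scalar B" using trace_square_scalar AB assms(5,7) by blast+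
  then show ?thesis using AB assms(1,4,6)
    by (auto intro!: proj_mult_in_products_upto_2 simp: proj_in_elements_of_order)
qed

lemma proj_in_products_upto_2_unipotent:
  fixes M :: "'a::field^2^2"
  assumes "(2::'a) \<noteq> 0" "Factorial_Ring.prime p" "det M = 1" "\<not> scalar M" "trace M \<noteq> 2" "lucas (2::'a) p = 0"
  shows "proj M \<in> products_upto PSL2 (elements_of_order p PSL2) 2"
proof -
  \<comment> \<open>With both traces equal to 2 the point d = 1, c = 0 lies on the conic for every
    \<open>M\<close>.\<close>
  have "1\<^sup>2 + 0\<^sup>2 - trace M * 0 * 1 - 2 * 1 + 2 * 0 + 1 = (0::'a)" by simp
  then obtain A B where AB: "M = A ** B" "det A = 1" "det B = 1" "trace A = 2" "trace B = 2"
    by (rule factor_with_traces[OF assms(3,4)])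
  have one: "X = mat 1" if "scalar X" "trace X = 2" for X :: "'a^2^2"
  proof -
    have "\<exists>k. X = mat k" using that(1) by (simp only: scalar_iff_mat)
    then obtain k where k: "X = mat k" ..
    have "k + k = 2" using that(2) unfolding k mat_eq_mat2 trace_mat2 .
    then have "2 * k = 2 * 1" by (simp only: mult_2[symmetric] mult_1_right)
    then have "k = 1" using assms(1) by (simp only: mult_cancel_left simp_thms)
    then show ?thesis by (simp only: k)
  qed
  \<comment> \<open>A scalar factor would be the identity, making \<open>M\<close> equal to the
    other factor, of trace 2.\<close>
  have "\<not> scalar A" "\<not> scalar B" using one[of A] one[of B] AB assms(5) by auto
  then show ?thesis using AB assms(2,6)
    by (auto intro!: proj_mult_in_products_upto_2 simp: proj_in_elements_of_order)
qed

lemma proj_in_products_upto_2_odd_char: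
  fixes A M :: "'a::{field,finite}^2^2"
  assumes 2: "(2::'a) \<noteq> 0" and q: "primepow CARD('a)" and p: "Factorial_Ring.prime p" "odd p"
    and A: "det A = 1" "proj A \<in> elements_of_order p PSL2" and M: "det M = 1"
  shows "proj M \<in> products_upto PSL2 (elements_of_order p PSL2) 2"
proof -
  have four: "(4::'a) \<noteq> 0" using 2 by (simp only: four_eq_2_mult_2 mult_eq_0_iff simp_thms)
  have main: "proj M \<in> products_upto PSL2 (elements_of_order p PSL2) 2"
    if M: "det M = 1" "\<not> scalar M" "trace M \<noteq> 2" for M :: "'a^2^2"
  proof -
    define \<tau> where "\<tau> = trace A"
    have \<tau>: "lucas \<tau> p = 0" using A p by (simp add: proj_in_elements_of_order \<tau>_def)
    have "\<tau> \<noteq> 0" using \<tau> lucas_zero_odd p(2) by blast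
    show ?thesis
    proof (cases "\<tau>\<^sup>2 = 4")
      case True
      have "lucas (- \<tau>) p = 0"
        using A p proj_in_elements_of_order[of "- A" p] by (simp add: \<tau>_def proj_uminus)
      then have "lucas (2::'a) p = 0" using True \<tau> by (auto simp: square_eq_4_iff)
      then show ?thesis using proj_in_products_upto_2_unipotent[OF 2 p(1) M] by blast
    next
      case False
      have "\<exists>c d. d\<^sup>2 + c\<^sup>2 - trace M * c * d - \<tau> * d + \<tau> * c + 1 = 0"
      proof (cases "(trace M)\<^sup>2 = 4")
        case True
        then have t: "trace M = - 2" using M(3) by (simp add: square_eq_4_iff)
        \<comment> \<open>For trace -2 the quadratic part is (c + d)^2. On the line c = -d the
          equation becomes 1 = 2 \<open>\<tau>\<close> d.\<close>
        define d where "d = 1 / (2 * \<tau>)"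
        have "2 * \<tau> * d = 1" using 2 \<open>\<tau> \<noteq> 0\<close> by (simp add: d_def)
        moreover have "d\<^sup>2 + (-d)\<^sup>2 - (-2) * (-d) * d - \<tau> * d + \<tau> * (-d) + 1 = 1 - 2 * \<tau> * d"
          by (simp add: algebra_simps power2_eq_square)
        ultimately show ?thesis unfolding t by (metis diff_self)
      next
        case False
        then show ?thesis using conic_point[OF False q] by metis
      qed
      then obtain c d where "d\<^sup>2 + c\<^sup>2 - trace M * c * d - \<tau> * d + \<tau> * c + 1 = 0" by blast
      then show ?thesis using proj_in_products_upto_2[OF p(1) M(1,2) \<tau> False \<tau> False] by blast
    qed
  qed
  show ?thesis
  proof (cases "scalar M")
    case True
    then show ?thesis by (intro proj_scalar_in_products_upto M)
  next
    case False
    show ?thesis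
    proof (cases "trace M = 2")
      case True
      have "(-2::'a) \<noteq> 2"
      proof
        assume "(-2::'a) = 2"
        then have "(4::'a) = 0" by (simp add: neg_eq_iff_add_eq_0)
        then show False using four by blast
      qed
      then show ?thesis using main[of "- M"] M True False by (simp add: proj_uminus)
    qed (use main M False in blast)
  qed
qed

lemma proj_in_products_upto_2_char_2:
  fixes A M :: "'a::{field,finite}^2^2"
  assumes 2: "(2::'a) = 0" and q: "primepow CARD('a)" and p: "Factorial_Ring.prime p" "odd p"
    and A: "det A = 1" "proj A \<in> elements_of_order p PSL2" and M: "det M = 1" "trace M \<noteq> 0"
  shows "proj M \<in> products_upto PSL2 (elements_of_order p PSL2) 2"
proof (cases "scalar M")
  case True
  then show ?thesis by (intro proj_scalar_in_products_upto M)
next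
  case False
  have four: "(4::'a) = 0" using 2 by (simp only: four_eq_2_mult_2 mult_eq_0_iff simp_thms)
  define \<tau> where "\<tau> = trace A"
  have \<tau>: "lucas \<tau> p = 0" using A p by (simp add: proj_in_elements_of_order \<tau>_def)
  have "\<tau> \<noteq> 0" using \<tau> lucas_zero_odd p(2) by blast
  then have \<tau>4: "\<tau>\<^sup>2 \<noteq> 4" using four by simp
  have "(trace M)\<^sup>2 \<noteq> 4" using four M(2) by simp
  then obtain c d where "d\<^sup>2 + c\<^sup>2 - trace M * c * d - \<tau> * d + \<tau> * c + 1 = 0"
    using conic_point[OF _ q] by blast
  then show ?thesis using proj_in_products_upto_2[OF p(1) M(1) False \<tau> \<tau>4 \<tau> \<tau>4] by blast
qed

text \<open>The quadratic part is (c + d)^2 in characteristic 2. On the line d = -c only the linear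
  equation (\<open>\<sigma>\<close> + \<open>\<tau>\<close>) c + 1 = 0 remains.\<close>

lemma conic_point_char_2_involution:
  fixes \<tau> \<sigma> :: "'a::field"
  assumes "(2::'a) = 0" "\<sigma> \<noteq> \<tau>"
  obtains c d where "d\<^sup>2 + c\<^sup>2 - 0 * c * d - \<tau> * d + \<sigma> * c + 1 = 0"
proof -
  have "\<sigma> + \<tau> \<noteq> 0"
  proof
    assume "\<sigma> + \<tau> = 0"
    then have "\<sigma> - \<tau> = - (2 * \<tau>)" by (simp add: algebra_simps eq_neg_iff_add_eq_0)
    then show False using assms by simp
  qed
  define c where "c = - 1 / (\<sigma> + \<tau>)"
  have "(\<sigma> + \<tau>) * c = - 1" using \<open>\<sigma> + \<tau> \<noteq> 0\<close> by (simp add: c_def)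
  moreover have "(- c)\<^sup>2 + c\<^sup>2 - 0 * c * (- c) - \<tau> * (- c) + \<sigma> * c + 1 = 2 * c\<^sup>2 + ((\<sigma> + \<tau>) * c + 1)"
    by (simp add: algebra_simps power2_eq_square)
  ultimately have "(- c)\<^sup>2 + c\<^sup>2 - 0 * c * (- c) - \<tau> * (- c) + \<sigma> * c + 1 = 0"
    using assms(1) by simp
  then show thesis by (rule that)
qed

text \<open>The second admissible trace comes from the square of \<open>A\<close>, which still has
  order \<open>p\<close> modulo the centre because \<open>p\<close> is odd. Its trace is
  \<open>\<tau>\<^sup>2\<close>, and this differs from \<open>\<tau>\<close> because trace 1 would
  force order 3.\<close>

lemma proj_in_products_upto_2_char_2_involution:
  fixes A M :: "'a::field^2^2"
  assumes 2: "(2::'a) = 0" and p: "Factorial_Ring.prime p" "odd p" "p \<noteq> 3"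
    and A: "det A = 1" "proj A \<in> elements_of_order p PSL2"
    and M: "det M = 1" "\<not> scalar M" "trace M = 0"
  shows "proj M \<in> products_upto PSL2 (elements_of_order p PSL2) 2"
proof -
  interpret group "PSL2 :: ('a^2^2) set monoid" by (rule group_PSL2)
  have four: "(4::'a) = 0" using 2 by (simp only: four_eq_2_mult_2 mult_eq_0_iff simp_thms)
  define \<tau> where "\<tau> = trace A"
  have sA: "\<not> scalar A" and \<tau>: "lucas \<tau> p = 0"
    using A p by (simp_all add: proj_in_elements_of_order \<tau>_def)
  have "\<tau> \<noteq> 0" using \<tau> lucas_zero_odd p(2) by blast
  have xA: "proj A \<in> carrier PSL2" "ord (proj A) = p"
    using A(2) by (simp_all add: elements_of_order_def)
  have "\<tau> \<noteq> 1"
  proof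
    assume "\<tau> = 1"
    then have "scalar (A [^]\<^bsub>SL2\<^esub> (3::nat))"
      using scalar_SL2_pow[OF A(1) sA, of 3] by (simp add: \<tau>_def numeral_3_eq_3)
    then have "proj A [^]\<^bsub>PSL2\<^esub> (3::nat) = \<one>\<^bsub>PSL2\<^esub>"
      using A(1) by (simp add: proj_pow proj_eq_one_iff det_SL2_pow)
    then have "p dvd 3" using pow_eq_id[OF xA(1), of 3] xA(2) by simp
    moreover have "Factorial_Ring.prime (3::nat)" by simp
    ultimately show False using p(1,3) primes_dvd_imp_eq by blast
  qed
  have d2: "det (A ** A) = 1" using A(1) by (simp add: det_mul)
  have tr2: "trace (A ** A) = \<tau>\<^sup>2" using trace_mult_self[OF A(1)] 2 by (simp add: \<tau>_def)
  have "lucas (\<tau>\<^sup>2) p = 0"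
  proof -
    have "\<not> p dvd 2" using p(1,2) by (metis primes_dvd_imp_eq two_is_prime_nat even_numeral)
    then have "proj A [^]\<^bsub>PSL2\<^esub> (2::nat) \<noteq> \<one>\<^bsub>PSL2\<^esub>" using pow_eq_id[OF xA(1), of 2] xA(2) by simp
    moreover have "proj A [^]\<^bsub>PSL2\<^esub> (2::nat) = proj (A ** A)"
      using A(1) xA(1) by (simp add: numeral_2_eq_2 proj_mult)
    moreover have "(proj A [^]\<^bsub>PSL2\<^esub> (2::nat)) [^]\<^bsub>PSL2\<^esub> p = \<one>\<^bsub>PSL2\<^esub>"
      using pow_eq_id[OF xA(1), of "2 * p"] xA by (simp add: nat_pow_pow)
    ultimately have "proj (A ** A) \<in> elements_of_order p PSL2"
      using ord_eq_prime_iff[OF _ p(1), of "proj (A ** A)"] d2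
      by (simp add: elements_of_order_def proj_in_carrier)
    then show ?thesis using d2 p(1) tr2 by (simp add: proj_in_elements_of_order)
  qed
  moreover have "\<tau>\<^sup>2 \<noteq> \<tau>" using \<open>\<tau> \<noteq> 0\<close> \<open>\<tau> \<noteq> 1\<close> by (simp add: power2_eq_square)
  from conic_point_char_2_involution[OF 2 this] obtain c d
    where "d\<^sup>2 + c\<^sup>2 - trace M * c * d - \<tau> * d + \<tau>\<^sup>2 * c + 1 = 0" unfolding M(3) by blast
  moreover have "\<tau>\<^sup>2 \<noteq> 4" "(\<tau>\<^sup>2)\<^sup>2 \<noteq> 4" using four \<open>\<tau> \<noteq> 0\<close> by simp_all
  ultimately show ?thesis using proj_in_products_upto_2[OF p(1) M(1,2) \<tau>] by blast
qed

lemma lucas_3: "lucas t 3 = t\<^sup>2 - 1"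
  by (simp add: numeral_3_eq_3 power2_eq_square)

text \<open>With both traces 1, the point c = 0, d = z lies on the conic, because -z = z in
  characteristic 2.\<close>

lemma proj_in_products_upto_2_cube_root:
  fixes M :: "'a::field^2^2"
  assumes 2: "(2::'a) = 0" and M: "det M = 1" "\<not> scalar M" "trace M = 0"
    and z: "z\<^sup>2 + z + 1 = (0::'a)"
  shows "proj M \<in> products_upto PSL2 (elements_of_order 3 PSL2) 2"
proof -
  have "(4::'a) = 0" using 2 by (simp only: four_eq_2_mult_2 mult_eq_0_iff simp_thms)
  then have one: "(1::'a)\<^sup>2 \<noteq> 4" by simp
  have "z\<^sup>2 + 0\<^sup>2 - trace M * 0 * z - 1 * z + 1 * 0 + 1 = (z\<^sup>2 + z + 1) - 2 * z"
    by (simp add: algebra_simps)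
  then have "z\<^sup>2 + 0\<^sup>2 - trace M * 0 * z - 1 * z + 1 * 0 + 1 = 0" using z 2 by simp
  then show ?thesis
    using proj_in_products_upto_2[of 3 M 1 1 z 0] M one by (simp add: lucas_3)
qed

lemma proj_in_products_upto_3_char_2:
  fixes A M :: "'a::{field,finite}^2^2"
  assumes 2: "(2::'a) = 0" and q: "primepow CARD('a)" "CARD('a) \<ge> 4"
    and A: "det A = 1" "proj A \<in> elements_of_order 3 PSL2" and M: "det M = 1"
  shows "proj M \<in> products_upto PSL2 (elements_of_order 3 PSL2) 3"
proof -
  have ok: "proj X \<in> products_upto PSL2 (elements_of_order 3 PSL2) 2"
    if "det X = 1" "trace X \<noteq> 0" for X :: "'a^2^2"
    using proj_in_products_upto_2_char_2[OF 2 q(1) _ _ A that] by simp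
  have "(4::'a) = 0" using 2 by (simp only: four_eq_2_mult_2 mult_eq_0_iff simp_thms)
  then have one: "(1::'a)\<^sup>2 \<noteq> 4" by simp
  show ?thesis
  proof (cases "trace M = 0 \<and> \<not> scalar M")
    case True
    \<comment> \<open>A non-scalar \<open>M\<close> of trace 0 splits into \<open>X\<close> of trace
      1, which has order 3, and \<open>Y\<close> of trace \<open>\<sigma>\<close>. The conic needs
      \<open>\<sigma>\<close> different from 1; \<open>\<sigma>\<close> nonzero makes
      \<open>Y\<close> a product of two elements of order 3.\<close>
    have "\<not> UNIV \<subseteq> {0, 1::'a}"
      using card_mono[of "{0, 1::'a}" UNIV] q(2) by (auto simp: card_insert_if)
    then obtain \<sigma> :: 'a where \<sigma>: "\<sigma> \<noteq> 0" "\<sigma> \<noteq> 1" by blast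
    from conic_point_char_2_involution[OF 2 \<sigma>(2)] obtain c d
      where "d\<^sup>2 + c\<^sup>2 - trace M * c * d - 1 * d + \<sigma> * c + 1 = 0" using True by metis
    then obtain X Y
      where XY: "M = X ** Y" "det X = 1" "det Y = 1" "trace X = 1" "trace Y = \<sigma>"
      using factor_with_traces[OF M conjunct2[OF True]] by blast
    have "\<not> scalar X" using trace_square_scalar XY one by metis
    then have "proj X \<in> elements_of_order 3 PSL2" using XY by (simp add: proj_in_elements_of_order lucas_3)
    then show ?thesis
      using proj_mult_in_products_upto[OF XY(2,3) _ ok] XY \<sigma>(1) by (simp add: numeral_3_eq_3 numeral_2_eq_2)
  next
    case False
    then have "proj M \<in> products_upto PSL2 (elements_of_order 3 PSL2) 2"
      using ok proj_scalar_in_products_upto M by blast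
    then show ?thesis using products_upto_mono[of 2 3] by fastforce
  qed
qed

section \<open>Lower bounds\<close>

text \<open>The companion matrix of trace 0. Its square is -1, so its class has order 2 in every
  characteristic.\<close>

definition involution :: "'a::field^2^2" where "involution = mat2 0 (-1) 1 0"

lemma involution_simps [simp]: "det involution = 1" "trace involution = 0" "\<not> scalar involution"
  by (simp_all add: involution_def)

lemma involution_notin_elements_of_order:
  assumes "Factorial_Ring.prime p" "odd p"
  shows "proj (involution :: 'a::field^2^2) \<notin> elements_of_order p PSL2"
  using assms lucas_zero_odd by (simp add: proj_in_elements_of_order)

lemma products_upto_1_PSL2:
  "products_upto (PSL2 :: ('a::field^2^2) set monoid) (elements_of_order p PSL2) (Suc 0) =
    insert \<one>\<^bsub>PSL2\<^esub> (elements_of_order p PSL2)"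
proof -
  interpret group "PSL2 :: ('a^2^2) set monoid" by (rule group_PSL2)
  show ?thesis unfolding products_upto_Suc products_upto_0
    by (force simp: elements_of_order_def)
qed

lemma involution_notin_products_upto_1:
  assumes "Factorial_Ring.prime p" "odd p"
  shows "proj (involution :: 'a::field^2^2) \<notin> products_upto PSL2 (elements_of_order p PSL2) 1"
  using involution_notin_elements_of_order[OF assms] proj_eq_one_iff[of "involution :: 'a^2^2"] by (simp add: products_upto_1_PSL2)

text \<open>In characteristic 2 an element of order 3 lifts to trace 1. If two such lifts multiply
  to the involution, the sum of the first column of the left factor is a root of z^2 + z +
  1.\<close>

lemma involution_notin_products_upto_2:
  assumes 2: "(2::'a::field) = 0" and root: "\<And>z::'a. z\<^sup>2 + z + 1 \<noteq> 0"
  shows "proj (involution :: 'a^2^2) \<notin> products_upto PSL2 (elements_of_order 3 PSL2) 2"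
proof
  let ?S = "elements_of_order 3 (PSL2 :: ('a^2^2) set monoid)"
  interpret group "PSL2 :: ('a^2^2) set monoid" by (rule group_PSL2)
  have p: "Factorial_Ring.prime (3::nat)" "odd (3::nat)" by simp_all
  have J1: "proj involution \<noteq> (\<one>\<^bsub>PSL2\<^esub> :: ('a^2^2) set)" "proj (involution :: 'a^2^2) \<notin> ?S"
    using proj_eq_one_iff[of "involution :: 'a^2^2"] involution_notin_elements_of_order[OF p] by simp_all
  assume "proj (involution :: 'a^2^2) \<in> products_upto PSL2 ?S 2"
  then obtain x y where xy: "proj (involution :: 'a^2^2) = x \<otimes>\<^bsub>PSL2\<^esub> y" "x \<in> ?S" "y \<in> insert \<one>\<^bsub>PSL2\<^esub> ?S"
    unfolding numeral_2_eq_2 products_upto_Suc[of _ _ "Suc 0"] products_upto_1_PSL2 using J1(1) by blast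
  have xc: "x \<in> carrier PSL2" using xy(2) by (simp add: elements_of_order_def)
  \<comment> \<open>If \<open>y\<close> were the identity, the involution itself would have order
    3.\<close>
  have yS: "y \<in> ?S" using xy xc J1(2) by auto
  have yc: "y \<in> carrier PSL2" using yS by (simp add: elements_of_order_def)
  obtain A B where AB: "det A = 1" "x = proj A" "det B = 1" "y = proj B"
    using xc yc by (auto simp: carrier_PSL2)
  have "proj (A ** B) = proj involution" using xy(1) AB by (simp add: proj_mult)
  moreover have "det (A ** B) = 1" using AB by (simp add: det_mul)
  ultimately obtain k where k: "k * k = 1" "A ** B = mat k ** involution" using proj_eqD by blast
  \<comment> \<open>In characteristic 2 the only square root of 1 is 1, so lifts are unique and the
    traces below are determined.\<close>
  have sq1: "u = 1" if "u\<^sup>2 = 1" for u :: 'a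
  proof -
    have "(u - 1)\<^sup>2 = (u\<^sup>2 - 1) - 2 * (u - 1)" by (simp add: algebra_simps power2_eq_square)
    then have "(u - 1)\<^sup>2 = 0" using that 2 by simp
    then show ?thesis by simp
  qed
  have "k = 1" using sq1[of k] k(1) by (simp only: power2_eq_square)
  then have ABJ: "A ** B = involution" using k(2) by simp
  have "(trace A)\<^sup>2 = 1" "(trace B)\<^sup>2 = 1"
    using xy(2) yS AB p(1) by (simp_all add: proj_in_elements_of_order lucas_3)
  then have tr: "trace A = 1" "trace B = 1" by (blast intro: sq1)+
  obtain a b c d where A: "A = mat2 a b c d" by (rule mat2_cases)
  have det: "a * d - b * c = 1" using AB(1) A by simp
  \<comment> \<open>The adjugate inverts \<open>A\<close>, which expresses \<open>B\<close>, and
    hence its trace, through the entries of \<open>A\<close>.\<close>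
  have "mat2 d (-b) (-c) a ** A = mat 1" using det by (simp add: A mat_eq_mat2 algebra_simps)
  then have "B = mat2 d (-b) (-c) a ** (A ** B)" by (simp add: matrix_mul_assoc)
  then have "B = mat2 d (-b) (-c) a ** involution" by (simp only: ABJ)
  then have "trace B = c - b" by (simp add: involution_def)
  then have b: "b = c - 1" and d: "d = 1 - a" using tr A by (simp_all add: algebra_simps)
  have "(a + c)\<^sup>2 + (a + c) + 1 = 1 - (a * (1 - a) - (c - 1) * c) + 2 * (a * c + a + c)"
    by (simp add: algebra_simps power2_eq_square)
  then have "(a + c)\<^sup>2 + (a + c) + 1 = 0" using det[unfolded b d] 2 by simp
  then show False using root by blast
qed

section \<open>Cube roots of unity\<close>

definition units_monoid :: "'a::field itself \<Rightarrow> 'a monoid" where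
  "units_monoid _ = \<lparr>carrier = UNIV - {0}, monoid.mult = (*), one = 1\<rparr>"

lemma group_units_monoid: "group (units_monoid TYPE('a::field))"
proof (rule groupI)
  fix x :: 'a assume "x \<in> carrier (units_monoid TYPE('a))"
  then show "\<exists>y\<in>carrier (units_monoid TYPE('a)). y \<otimes>\<^bsub>units_monoid TYPE('a)\<^esub> x = \<one>\<^bsub>units_monoid TYPE('a)\<^esub>"
    by (intro bexI[of _ "inverse x"]) (auto simp: units_monoid_def)
qed (auto simp: units_monoid_def)

lemma units_monoid_pow: "(x::'a::field) [^]\<^bsub>units_monoid TYPE('a)\<^esub> (n::nat) = x ^ n"
  by (induction n) (simp_all add: units_monoid_def nat_pow_def mult.commute)

lemma order_units_monoid: "Coset.order (units_monoid TYPE('a::{field,finite})) = CARD('a) - 1"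
  by (simp add: Coset.order_def units_monoid_def)

text \<open>Cauchy's theorem in the multiplicative group gives a nontrivial cube root of 1; cancel z
  - 1 in z^3 - 1.\<close>

lemma cube_root_exists:
  assumes "3 dvd CARD('a::{field,finite}) - 1"
  obtains z :: "'a::{field,finite}" where "z\<^sup>2 + z + 1 = 0"
proof -
  interpret group "units_monoid TYPE('a)" by (rule group_units_monoid)
  obtain z :: 'a where z: "z \<noteq> 1" "z ^ 3 = 1"
  proof (rule Cauchy[of 3])
    show "3 dvd Coset.order (units_monoid TYPE('a))" using assms by (simp add: order_units_monoid)
    show thesis if "x \<noteq> \<one>\<^bsub>units_monoid TYPE('a)\<^esub>"
        "x [^]\<^bsub>units_monoid TYPE('a)\<^esub> (3::nat) = \<one>\<^bsub>units_monoid TYPE('a)\<^esub>" for x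
      using that \<open>\<And>z. z \<noteq> 1 \<Longrightarrow> z ^ 3 = 1 \<Longrightarrow> thesis\<close>
      unfolding units_monoid_pow by (simp add: units_monoid_def)
  qed simp_all
  have "(z - 1) * (z\<^sup>2 + z + 1) = z ^ 3 - 1" by (simp add: algebra_simps power2_eq_square power3_eq_cube)
  then have "z\<^sup>2 + z + 1 = 0" using z by simp
  then show thesis by (rule that)
qed

text \<open>A root satisfies z^3 = 1, and also z^(3m + 1) = 1 by Lagrange. Hence z = 1, and the
  equation reads 3 = 0.\<close>

lemma no_cube_root:
  assumes "(3::'a::{field,finite}) \<noteq> 0" "CARD('a) = 3 * m + 2"
  shows "(z::'a)\<^sup>2 + z + 1 \<noteq> 0"
proof
  interpret group "units_monoid TYPE('a)" by (rule group_units_monoid)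
  assume z: "z\<^sup>2 + z + 1 = 0"
  then have "z \<noteq> 0" by auto
  have "z ^ 3 - 1 = (z - 1) * (z\<^sup>2 + z + 1)" by (simp add: algebra_simps power2_eq_square power3_eq_cube)
  then have z3: "z ^ 3 = 1" using z by simp
  have "z [^]\<^bsub>units_monoid TYPE('a)\<^esub> Coset.order (units_monoid TYPE('a)) = \<one>\<^bsub>units_monoid TYPE('a)\<^esub>"
    using \<open>z \<noteq> 0\<close> by (intro pow_order_eq_1) (simp add: units_monoid_def)
  then have "z ^ (3 * m + 1) = 1"
    unfolding units_monoid_pow order_units_monoid by (simp add: assms(2) units_monoid_def)
  then have "z = 1" using z3 by (simp add: power_add power_mult)
  then show False using z assms(1) by simp
qed

lemma power2_mod_3: "(2::nat) ^ (2 * n) mod 3 = 1"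
  by (induction n) (simp_all add: power_mult mod_mult_eq mod_mult_right_eq[symmetric])

section \<open>Determination of the width\<close>

theorem proposition3p4:
  fixes G :: "('a::{field,finite} ^ 2 ^ 2) set monoid" and p q :: nat
  assumes "primepow q" and "q \<ge> 4"
    and "CARD('a) = q" and "G = PSL2"
    and "Factorial_Ring.prime p" and "odd p" and "p dvd Coset.order G"
  shows "p_width p G =
    (if p = 3 \<and> (\<exists>n::nat. q = 2 ^ (2 * n + 1) \<and> q \<ge> 8) then 3 else 2)"
proof -
  let ?P = "products_upto G (elements_of_order p G)"
  note p = assms(5,6)
  have q: "primepow CARD('a)" "CARD('a) \<ge> 4" using assms(1-3) by simp_all
  have "finite (carrier G)" unfolding assms(4) carrier_PSL2 by simp
  then obtain x where "x \<in> carrier G" "x \<noteq> \<one>\<^bsub>G\<^esub>" "x [^]\<^bsub>G\<^esub> p = \<one>\<^bsub>G\<^esub>"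
    using group.Cauchy[OF group_PSL2 _ p(1)] assms(4,7) by blast
  then have "x \<in> elements_of_order p PSL2"
    using group.ord_eq_prime_iff[OF group_PSL2 _ p(1)] assms(4) by (auto simp: elements_of_order_def)
  then obtain A :: "'a^2^2" where A: "det A = 1" "proj A \<in> elements_of_order p PSL2"
    by (auto simp: elements_of_order_def carrier_PSL2)
  show ?thesis
  proof (cases "p = 3 \<and> (\<exists>n. q = 2 ^ (2 * n + 1))")
    case True
    then obtain n where p3: "p = 3" and n: "q = 2 ^ (2 * n + 1)" by blast
    \<comment> \<open>The case split omits the bound 8; it follows since q = 2 is excluded by q
      being at least 4.\<close>
    have "n \<noteq> 0" using n assms(2) by (intro notI) simp
    then have "(2::nat) ^ 3 \<le> q" unfolding n by (intro power_increasing) auto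
    then have "q \<ge> 8" by simp
    have 2: "(2::'a) = 0" using two_eq_0_if_CARD_power_2 n assms(3) by blast
    have "(3::'a) = 2 + 1" by simp
    then have "(3::'a) \<noteq> 0" using 2 by simp
    moreover have "q mod 3 = 2" using power2_mod_3[of n] mod_mult_right_eq[of "2::nat" "2 ^ (2 * n)" 3] unfolding n by simp
    then have "CARD('a) = 3 * (q div 3) + 2" using assms(3) by presburger
    ultimately have "\<And>z::'a. z\<^sup>2 + z + 1 \<noteq> 0" using no_cube_root by blast
    then have "proj (involution :: 'a^2^2) \<notin> ?P 2" using involution_notin_products_upto_2[OF 2] assms(4) p3 by simp
    moreover have "proj (involution :: 'a^2^2) \<in> carrier G" by (simp add: proj_in_carrier assms(4))
    moreover have "carrier G \<subseteq> ?P 3"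
      using proj_in_products_upto_3_char_2[OF 2 q] A assms(4) p3 by (auto simp: carrier_PSL2)
    ultimately have "p_width p G = enat (Suc 2)" by (intro p_width_eqI) (auto simp: numeral_3_eq_3)
    then show ?thesis using True \<open>q \<ge> 8\<close> by (auto simp: numeral_eq_enat)
  next
    case False
    have "proj M \<in> products_upto PSL2 (elements_of_order p PSL2) 2" if M: "det M = 1" for M :: "'a^2^2"
    proof (cases "(2::'a) = 0")
      case 2: True
      show ?thesis
      proof (cases "trace M = 0 \<and> \<not> scalar M")
        case M0: True
        show ?thesis
        proof (cases "p = 3")
          case True
          have "even q" using two_neq_0_if_odd_CARD 2 assms(3) by blast
          then obtain k where k: "q = 2 ^ k" using primepow_evenE[OF assms(1)] by blast
          \<comment> \<open>An odd exponent falls under the exceptional case, so q is a power of 4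
            and 3 divides q - 1.\<close>
          then obtain j where "k = 2 * j" using False True by (metis evenE oddE)
          then have "q mod 3 = 1" using power2_mod_3 k by simp
          then have "3 dvd CARD('a) - 1" unfolding assms(3) by presburger
          then show ?thesis using cube_root_exists proj_in_products_upto_2_cube_root[OF 2 M] M0 True by metis
        qed (use proj_in_products_upto_2_char_2_involution[OF 2 p _ A M] M0 in blast)
      qed (use proj_in_products_upto_2_char_2[OF 2 q(1) p A M] proj_scalar_in_products_upto M in blast)
    qed (use proj_in_products_upto_2_odd_char[OF _ q(1) p A M] in blast)
    then have "carrier G \<subseteq> ?P (Suc 1)" using assms(4) by (auto simp: carrier_PSL2 numeral_2_eq_2)
    moreover have "\<not> carrier G \<subseteq> ?P 1"
      using involution_notin_products_upto_1[OF p, where 'a = 'a] proj_in_carrier[of "involution :: 'a^2^2"] assms(4) by auto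
    ultimately have "p_width p G = enat (Suc 1)" by (rule p_width_eqI)
    then show ?thesis using False by (auto simp: numeral_eq_enat numeral_2_eq_2)
  qed
qed

end
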